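(* Any randomized algorithm that processes a data stream of $n$ items from a universe $\mathcal{U}$ with $|\mathcal{U}|\ge\Omega(\varepsilon^{-1}\log(\varepsilon n))$ and outputs a sketch that solves the all-quantiles approximation problem with multiplicative error $\varepsilon$ with probability at least $2/3$ requires the sketch to have size $\Omega\big(\varepsilon^{-1}\log(\varepsilon n)\log(\varepsilon|\mathcal{U}|)\big)$ bits.
   Context: $\mathcal{U}$ is totally ordered; for a stream $x_1,\dots,x_n$ and $y\in\mathcal{U}$, $\operatorname{R}(y)=|\{i:x_i\le y\}|$. A sketch solves the all-quantiles approximation problem with multiplicative error $\varepsilon$ if from it one can compute, for every $y\in\mathcal{U}$ simultaneously, an estimate $\hat{\operatorname{R}}(y)$ with $|\hat{\operatorname{R}}(y)-\operatorname{R}(y)|\le\varepsilon\operatorname{R}(y)$. The lower bound applies to arbitrary (including offline, non-comparison-based) algorithms.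
   Formalization: False as stated for |U| near ε⁻¹log(εn). Proved: the stated bound if |U| ≥ Cε⁻¹log(εn)^(1+δ), any C,δ>0; and for |U| ≥ Cε⁻¹log(εn), |U| ≥ 2, the bound with log(ε|U|/log(εn)) in place of log(ε|U|). Assumes εn ≥ 1 and ε ≤ ε₀ < 1; constants depend on C, δ, ε₀. *)

theory Defs
  imports "HOL-Probability.Probability"
begin

definition data_streams :: "'a set \<Rightarrow> nat \<Rightarrow> 'a list set" where
  "data_streams U n = {xs. length xs = n \<and> set xs \<subseteq> U}"

definition stream_rank :: "'a::linorder list \<Rightarrow> 'a \<Rightarrow> nat" where
  "stream_rank xs y = card {i. i < length xs \<and> xs ! i \<le> y}"

definition all_quantiles_approx ::
    "real \<Rightarrow> 'a::linorder set \<Rightarrow> 'a list \<Rightarrow> ('a \<Rightarrow> real) \<Rightarrow> bool" where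
  "all_quantiles_approx \<epsilon> U xs est \<longleftrightarrow>
     (\<forall>y\<in>U. \<bar>est y - real (stream_rank xs y)\<bar> \<le> \<epsilon> * real (stream_rank xs y))"

text \<open>
  A randomized algorithm draws its coins from the probability space \<open>M\<close>; with coins \<open>\<omega>\<close> it turns
  the stream \<open>xs\<close> into the bit string \<open>sketch \<omega> xs\<close>, from which \<open>query\<close> computes the estimates.
  The sketch may depend on the whole stream in an arbitrary way, so offline algorithms and algorithms
  that are not comparison-based are included. The query may reuse the coins \<open>\<omega>\<close>, which are not
  charged to the size of the sketch: lower bounds proved in this model apply in particular to
  algorithms whose query sees nothing but the sketch.

  The success probability is required for every stream separately, but for all \<open>y\<close> simultaneously.
  A set that is not measurable has measure \<open>0\<close>, so the inequality also forces the success
  event to be measurable.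
\<close>

definition solves_all_quantiles ::
    "'w measure \<Rightarrow> ('w \<Rightarrow> 'a::linorder list \<Rightarrow> bool list) \<Rightarrow> ('w \<Rightarrow> bool list \<Rightarrow> 'a \<Rightarrow> real) \<Rightarrow>
     'a set \<Rightarrow> nat \<Rightarrow> real \<Rightarrow> real \<Rightarrow> bool" where
  "solves_all_quantiles M sketch query U n \<epsilon> p \<longleftrightarrow>
     prob_space M \<and>
     (\<forall>xs\<in>data_streams U n.
        p \<le> measure M {\<omega>\<in>space M. all_quantiles_approx \<epsilon> U xs (query \<omega> (sketch \<omega> xs))})"

definition sketch_size_le ::
    "'w measure \<Rightarrow> ('w \<Rightarrow> 'a list \<Rightarrow> bool list) \<Rightarrow> 'a set \<Rightarrow> nat \<Rightarrow> nat \<Rightarrow> bool" where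
  "sketch_size_le M sketch U n s \<longleftrightarrow>
     (\<forall>\<omega>\<in>space M. \<forall>xs\<in>data_streams U n. length (sketch \<omega> xs) \<le> s)"

end

theory Submission imports Defs begin

text \<open>
  If \<open>(1 + \<epsilon>) * R j < (1 - \<epsilon>) * R (j + 1)\<close> for all \<open>j < m\<close>, then no estimate is valid for two
  different ranks \<open>R j\<close>. Hence an \<open>m\<close>-element subset \<open>S\<close> of the universe can be recovered from a valid
  sketch of the stream in which the \<open>j\<close>-th smallest element of \<open>S\<close> has rank \<open>R j\<close>. The recursion
  \<open>R (j + 1) = \<lfloor>q * R j\<rfloor> + 1\<close> with \<open>q = (1 + \<epsilon>) / (1 - \<epsilon>)\<close> keeps \<open>R m \<le> n\<close> for \<open>m\<close> of order
  \<open>\<epsilon>\<^sup>-\<^sup>1 (1 + log (\<epsilon> n))\<close>. Averaging over the coins, one choice of the coins has to serve two thirds of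
  the \<open>|U| choose m\<close> subsets, so the size of the sketch is of order \<open>log (|U| choose m) \<ge> m log (|U| / m)\<close>.
\<close>

section \<open>Counting sketches\<close>

lemma card_bool_lists_length_le:
  "finite {bs::bool list. length bs \<le> s}" "card {bs::bool list. length bs \<le> s} = 2 ^ Suc s - 1"
proof -
  have eq: "{bs::bool list. length bs \<le> s} = {bs. set bs \<subseteq> UNIV \<and> length bs \<le> s}" by simp
  show "finite {bs::bool list. length bs \<le> s}"
    unfolding eq by (rule finite_lists_length_le) simp
  have "card {bs::bool list. length bs \<le> s} = (\<Sum>i\<le>s. 2 ^ i)"
    unfolding eq by (subst card_lists_length_le) simp_all
  also have "\<dots> = 2 ^ Suc s - 1"
    by (induction s) simp_all
  finally show "card {bs::bool list. length bs \<le> s} = 2 ^ Suc s - 1" .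
qed

text \<open>With the coins fixed, \<open>sketch\<close> is injective on the streams of
  \<open>F\<close> on which it succeeds, so it succeeds on at most \<open>2 ^ Suc s - 1\<close> of
  them. The expected number of successes is at least \<open>p * card F\<close>.\<close>

lemma card_distinguishable_streams_le:
  fixes U :: "'a::linorder set"
  assumes solves: "solves_all_quantiles M sketch query U n \<epsilon> p"
    and size: "sketch_size_le M sketch U n s"
    and p: "0 < p"
    and F: "F \<subseteq> data_streams U n" "finite F"
    and dist: "\<And>xs ys est. xs \<in> F \<Longrightarrow> ys \<in> F \<Longrightarrow> all_quantiles_approx \<epsilon> U xs est \<Longrightarrow>
       all_quantiles_approx \<epsilon> U ys est \<Longrightarrow> xs = ys"
  shows "p * real (card F) \<le> 2 ^ Suc s - 1"
proof -
  interpret prob_space M using solves by (simp add: solves_all_quantiles_def)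
  define A where
    "A xs = {\<omega>\<in>space M. all_quantiles_approx \<epsilon> U xs (query \<omega> (sketch \<omega> xs))}" for xs
  have pA: "p \<le> measure M (A xs)" if "xs \<in> F" for xs
    using solves F that by (auto simp: solves_all_quantiles_def A_def)
  \<comment> \<open>Positivity of \<open>p\<close> enters here: a set outside \<open>sets M\<close>
    would have measure 0.\<close>
  have mA: "A xs \<in> sets M" if "xs \<in> F" for xs
    using pA[OF that] p measure_notin_sets[of "A xs" M] by force
  have count: "(\<Sum>xs\<in>F. indicator (A xs) \<omega>) \<le> (2 ^ Suc s - 1 :: real)" if \<omega>: "\<omega> \<in> space M" for \<omega>
  proof -
    let ?G = "{xs\<in>F. \<omega> \<in> A xs}"
    have inj: "inj_on (sketch \<omega>) ?G"
    proof (rule inj_onI)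
      fix xs ys assume xy: "xs \<in> ?G" "ys \<in> ?G" "sketch \<omega> xs = sketch \<omega> ys"
      \<comment> \<open>With the same coins, equal sketches yield one estimate, which is then valid
        for both streams.\<close>
      show "xs = ys"
        by (rule dist[of xs ys "query \<omega> (sketch \<omega> xs)"]) (use xy in \<open>auto simp: A_def\<close>)
    qed
    have "sketch \<omega> ` ?G \<subseteq> {bs. length bs \<le> s}"
      using size F \<omega> by (auto simp: sketch_size_le_def)
    then have "card ?G \<le> 2 ^ Suc s - 1"
      using card_inj_on_le[OF inj] card_bool_lists_length_le by metis
    then have "real (card ?G) \<le> real (2 ^ Suc s - 1)"
      by (rule of_nat_mono)
    also have "\<dots> = 2 ^ Suc s - 1"
      by (subst of_nat_diff) simp_all
    finally have "real (card ?G) \<le> 2 ^ Suc s - 1" .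
    moreover have "(\<Sum>xs\<in>F. indicator (A xs) \<omega>) = real (card ?G)"
      using F(2) by (simp add: indicator_def if_distrib sum.If_cases Int_def)
    ultimately show ?thesis by simp
  qed
  have "p * real (card F) = (\<Sum>xs\<in>F. p)" by simp
  also have "\<dots> \<le> (\<Sum>xs\<in>F. measure M (A xs))" by (intro sum_mono pA)
  also have "\<dots> = (\<integral>\<omega>. (\<Sum>xs\<in>F. indicator (A xs) \<omega>) \<partial>M)"
    using mA by (subst Bochner_Integration.integral_sum) (auto simp: emeasure_eq_measure)
  also have "\<dots> \<le> (\<integral>\<omega>. (2 ^ Suc s - 1) \<partial>M)"
    using mA count by (intro integral_mono) (auto simp: emeasure_eq_measure)
  also have "\<dots> = 2 ^ Suc s - 1" by (simp add: prob_space)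
  finally show ?thesis .
qed

section \<open>Streams that encode subsets\<close>

text \<open>For monotone \<open>R\<close> with \<open>R 0 = 0\<close> and
  \<open>R (card S) = n\<close> this is the sorted stream in which the \<open>j\<close>-th smallest
  element of \<open>S\<close> fills the positions from \<open>R (j - 1)\<close> to
  \<open>R j - 1\<close>, counted from 0.\<close>

definition subset_stream :: "(nat \<Rightarrow> nat) \<Rightarrow> nat \<Rightarrow> 'a::linorder set \<Rightarrow> 'a list" where
  "subset_stream R n S = map (\<lambda>p. Min {z\<in>S. p < R (card {w\<in>S. w \<le> z})}) [0..<n]"

context
  fixes R :: "nat \<Rightarrow> nat" and n m :: nat and S :: "'a::linorder set"
  assumes R: "mono_on {..m} R" "R 0 = 0" "R m = n"
    and S: "finite S" "card S = m"
begin

text \<open>Makes the \<open>Min\<close> in \<open>subset_stream\<close> meaningful: the largest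
  element of \<open>S\<close> always qualifies, as its target rank is
  \<open>R m = n\<close>.\<close>

lemma subset_stream_index_nonempty:
  assumes "p < n"
  shows "{z\<in>S. p < R (card {w\<in>S. w \<le> z})} \<noteq> {}"
proof -
  have "S \<noteq> {}" using R S assms by auto
  then have "Max S \<in> S" "{w\<in>S. w \<le> Max S} = S" using S by auto
  then show ?thesis using R S assms by auto
qed

lemma subset_stream_data_streams:
  assumes "S \<subseteq> U"
  shows "subset_stream R n S \<in> data_streams U n"
proof -
  have "Min {z\<in>S. p < R (card {w\<in>S. w \<le> z})} \<in> S" if "p < n" for p
    using Min_in[OF _ subset_stream_index_nonempty[OF that]] S by auto
  then show ?thesis using assms by (auto simp: subset_stream_def data_streams_def)
qed

text \<open>If \<open>j\<close> elements of \<open>S\<close> are at most \<open>y\<close>, then the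
  entry at position \<open>p\<close> is at most \<open>y\<close> iff \<open>p < R j\<close>, so the
  counted positions form an initial segment.\<close>

lemma stream_rank_subset_stream:
  "stream_rank (subset_stream R n S) y = R (card {w\<in>S. w \<le> y})"
proof -
  let ?j = "card {w\<in>S. w \<le> y}"
  have jm: "?j \<le> m" using S by (metis (no_types, lifting) card_mono mem_Collect_eq subsetI)
  have key: "Min {z\<in>S. p < R (card {w\<in>S. w \<le> z})} \<le> y \<longleftrightarrow> p < R ?j" if p: "p < n" for p
  proof
    let ?Z = "{z\<in>S. p < R (card {w\<in>S. w \<le> z})}"
    have fin: "finite ?Z" using S by auto
    assume le: "Min ?Z \<le> y"
    have "Min ?Z \<in> ?Z" using Min_in[OF fin subset_stream_index_nonempty[OF p]] .
    then have "p < R (card {w\<in>S. w \<le> Min ?Z})" by simp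
    also have "card {w\<in>S. w \<le> Min ?Z} \<le> ?j"
      using S le by (intro card_mono) auto
    then have "R (card {w\<in>S. w \<le> Min ?Z}) \<le> R ?j"
      using jm by (intro mono_onD[OF R(1)]) auto
    finally show "p < R ?j" .
  next
    let ?Z = "{z\<in>S. p < R (card {w\<in>S. w \<le> z})}"
    let ?Y = "{w\<in>S. w \<le> y}"
    assume lt: "p < R ?j"
    then have ne: "?Y \<noteq> {}" using R(2) by (metis card.empty not_less_zero)
    have fY: "finite ?Y" using S by auto
    \<comment> \<open>The largest element of \<open>S\<close> not above \<open>y\<close> has the
      same number of elements of \<open>S\<close> up to it as \<open>y\<close> has, so it competes
      in the minimum \<open>Min ?Z\<close>.\<close>
    have M: "Max ?Y \<in> ?Y" by (rule Max_in[OF fY ne])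
    have "{w\<in>S. w \<le> Max ?Y} = ?Y"
    proof (intro set_eqI iffI)
      fix w assume "w \<in> {w\<in>S. w \<le> Max ?Y}"
      then show "w \<in> ?Y" using M by auto
    next
      fix w assume "w \<in> ?Y"
      then show "w \<in> {w\<in>S. w \<le> Max ?Y}" using Max_ge[OF fY] by auto
    qed
    then have "Max ?Y \<in> ?Z" using M lt by auto
    then have "Min ?Z \<le> Max ?Y" using S by (intro Min_le) auto
    then show "Min ?Z \<le> y" using M by auto
  qed
  have "{i. i < length (subset_stream R n S) \<and> subset_stream R n S ! i \<le> y} = {i. i < n \<and> i < R ?j}"
    using key by (auto simp: subset_stream_def)
  also have "\<dots> = {..<R ?j}"
    using mono_onD[OF R(1), of ?j m] jm R(3) by auto
  finally show ?thesis by (simp add: stream_rank_def)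
qed

end

section \<open>Recovering the subset from a valid sketch\<close>

lemma card_le_separates_subsets:
  fixes S T :: "'a::linorder set"
  assumes "finite S" "finite T" "S \<noteq> T"
  obtains y where "y \<in> S \<union> T" "card {w\<in>S. w \<le> y} \<noteq> card {w\<in>T. w \<le> y}"
proof -
  let ?D = "(S - T) \<union> (T - S)"
  \<comment> \<open>Below the least point of the symmetric difference the two sets agree, and at
    that point exactly one of them gains an element.\<close>
  define y where "y = Min ?D"
  have D: "finite ?D" "?D \<noteq> {}" using assms by auto
  have y: "y \<in> ?D" unfolding y_def by (rule Min_in[OF D])
  have below: "w \<in> S \<longleftrightarrow> w \<in> T" if "w < y" for w
    using that Min_le[OF D(1), of w] unfolding y_def by (meson DiffI UnCI leD)
  have "card {w\<in>S. w \<le> y} \<noteq> card {w\<in>T. w \<le> y}"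
  proof (cases "y \<in> S")
    case True
    then have "y \<notin> T" using y by auto
    then have "{w\<in>S. w \<le> y} = insert y {w\<in>T. w \<le> y}"
      using True below by (auto simp: le_less)
    then show ?thesis using \<open>y \<notin> T\<close> assms by simp
  next
    case False
    then have "y \<in> T" using y by auto
    then have "{w\<in>T. w \<le> y} = insert y {w\<in>S. w \<le> y}"
      using False below by (auto simp: le_less)
    then show ?thesis using False assms by simp
  qed
  then show ?thesis using that y by blast
qed

text \<open>By \<open>gap\<close>, the intervals of valid estimates for distinct ranks are disjoint.
  A valid estimate thus reveals how many elements of the encoded set lie up to each
  \<open>y\<close>, hence the set itself.\<close>

lemma choose_subsets_le_of_separated_ranks:
  fixes U :: "'a::linorder set"
  assumes solves: "solves_all_quantiles M sketch query U n \<epsilon> p"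
    and size: "sketch_size_le M sketch U n s"
    and p: "0 < p"
    and U: "finite U"
    and \<epsilon>: "0 < \<epsilon>" "\<epsilon> < 1"
    and R: "R 0 = 0" "R m = n"
    and gap: "\<And>j. j < m \<Longrightarrow> (1 + \<epsilon>) * real (R j) < (1 - \<epsilon>) * real (R (Suc j))"
  shows "p * real (card U choose m) \<le> 2 ^ Suc s - 1"
proof -
  have step: "R j \<le> R (Suc j)" if "j < m" for j
  proof -
    have "(1 - \<epsilon>) * real (R j) \<le> (1 + \<epsilon>) * real (R j)"
      using \<epsilon> by (intro mult_right_mono) auto
    also note gap[OF that]
    finally show ?thesis using \<epsilon> by simp
  qed
  have mono: "R i \<le> R j" if "i \<le> j" "j \<le> m" for i j
    using that by (induction j rule: dec_induct) (use step in \<open>auto intro: le_trans\<close>)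
  have mono_on: "mono_on {..m} R" using mono by (auto intro!: mono_onI)
  have sep: "i = j" if "\<bar>e - real (R i)\<bar> \<le> \<epsilon> * real (R i)" "\<bar>e - real (R j)\<bar> \<le> \<epsilon> * real (R j)"
    "i \<le> m" "j \<le> m" for i j and e :: real
    using that
  proof (induction i j rule: linorder_wlog)
    case (le i j)
    show ?case
    proof (rule ccontr)
      assume "i \<noteq> j"
      then have ij: "i < m" "Suc i \<le> j" using le by auto
      have "(1 - \<epsilon>) * real (R (Suc i)) \<le> (1 - \<epsilon>) * real (R j)"
        using mono[OF ij(2)] le \<epsilon> by simp
      then show False using gap[OF ij(1)] le by (auto simp: algebra_simps abs_le_iff)
    qed
  next
    case (sym i j)
    then show ?case by metis
  qed
  define P where "P = {S. S \<subseteq> U \<and> card S = m}"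
  have fP: "finite S" if "S \<in> P" for S using that U finite_subset by (auto simp: P_def)
  have cP: "card S = m" if "S \<in> P" for S using that by (auto simp: P_def)
  have rank: "stream_rank (subset_stream R n S) y = R (card {w\<in>S. w \<le> y})" if "S \<in> P" for S y
    using that by (intro stream_rank_subset_stream[OF mono_on R fP cP])
  have recover: "S = T" if ST: "S \<in> P" "T \<in> P"
    and "all_quantiles_approx \<epsilon> U (subset_stream R n S) est"
    and "all_quantiles_approx \<epsilon> U (subset_stream R n T) est" for S T est
  proof (rule ccontr)
    assume "S \<noteq> T"
    then obtain y where y: "y \<in> S \<union> T" "card {w\<in>S. w \<le> y} \<noteq> card {w\<in>T. w \<le> y}"
      using card_le_separates_subsets fP ST by metis
    have "y \<in> U" using y ST by (auto simp: P_def)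
    moreover have "card {w\<in>S. w \<le> y} \<le> m" "card {w\<in>T. w \<le> y} \<le> m"
      using fP cP ST by (metis (no_types, lifting) card_mono mem_Collect_eq subsetI)+
    ultimately show False
      using sep[of "est y" "card {w\<in>S. w \<le> y}" "card {w\<in>T. w \<le> y}"] that y rank
      by (auto simp: all_quantiles_approx_def)
  qed
  \<comment> \<open>The exact ranks are valid estimates, so \<open>recover\<close> also shows that
    distinct subsets give distinct streams, and no subset is lost in the count.\<close>
  have inj: "inj_on (subset_stream R n) P"
  proof (rule inj_onI)
    fix S T assume ST: "S \<in> P" "T \<in> P" "subset_stream R n S = subset_stream R n T"
    have "all_quantiles_approx \<epsilon> U (subset_stream R n S)
            (\<lambda>y. real (stream_rank (subset_stream R n S) y))"
      using \<epsilon> by (simp add: all_quantiles_approx_def)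
    then show "S = T" using recover ST by metis
  qed
  have "p * real (card (subset_stream R n ` P)) \<le> 2 ^ Suc s - 1"
  proof (rule card_distinguishable_streams_le[OF solves size p])
    show "subset_stream R n ` P \<subseteq> data_streams U n"
      using subset_stream_data_streams[OF mono_on R fP cP] by (auto simp: P_def)
    show "finite (subset_stream R n ` P)" using U by (auto simp: P_def)
  qed (use recover in blast)
  also have "card (subset_stream R n ` P) = card U choose m"
    using card_image[OF inj] n_subsets[OF U] by (simp add: P_def)
  finally show ?thesis .
qed

section \<open>Well separated ranks\<close>

primrec gap_rank :: "real \<Rightarrow> nat \<Rightarrow> nat" where
  "gap_rank q 0 = 0"
| "gap_rank q (Suc j) = nat \<lfloor>q * real (gap_rank q j)\<rfloor> + 1"

lemma gap_rank_greater: "q * real (gap_rank q j) < real (gap_rank q (Suc j))"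
  by simp linarith

text \<open>Rounding adds at most 1 per step, so the geometric sum
  \<open>1 + q + ... + q ^ (j - 1)\<close> is an upper bound.\<close>

lemma gap_rank_upper:
  assumes "1 < q"
  shows "real (gap_rank q j) \<le> (q ^ j - 1) / (q - 1)"
proof (induction j)
  case (Suc j)
  have "real (gap_rank q (Suc j)) \<le> q * real (gap_rank q j) + 1"
    using assms by (simp add: of_nat_nat)
  also have "\<dots> \<le> q * ((q ^ j - 1) / (q - 1)) + 1"
    using Suc assms by (intro add_right_mono mult_left_mono) auto
  also have "\<dots> = (q ^ Suc j - 1) / (q - 1)"
    using assms by (simp add: field_simps)
  finally show ?case .
qed simp

text \<open>With \<open>q - 1 = 2 * \<epsilon> / (1 - \<epsilon>)\<close>, the estimate
  \<open>q ^ j \<le> exp ((q - 1) * j)\<close> turns the hypothesis into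
  \<open>q ^ j \<le> 1 + 2 * \<epsilon> * n\<close>; dividing by \<open>q - 1\<close> leaves
  \<open>(1 - \<epsilon>) * n\<close>.\<close>

lemma gap_rank_le_exp:
  fixes \<epsilon> :: real
  assumes \<epsilon>: "0 < \<epsilon>" "\<epsilon> < 1"
    and j: "2 * \<epsilon> / (1 - \<epsilon>) * real j \<le> ln (1 + 2 * \<epsilon> * real n)"
  shows "gap_rank ((1 + \<epsilon>) / (1 - \<epsilon>)) j \<le> n"
proof -
  define q where "q = (1 + \<epsilon>) / (1 - \<epsilon>)"
  have q1: "q - 1 = 2 * \<epsilon> / (1 - \<epsilon>)" using \<epsilon> by (simp add: q_def field_simps)
  have q: "1 < q" using \<epsilon> by (simp add: q_def)
  have "q \<le> exp (q - 1)" using exp_ge_add_one_self[of "q - 1"] by simp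
  then have "q ^ j \<le> exp (q - 1) ^ j" using q by (intro power_mono) auto
  also have "\<dots> = exp ((q - 1) * real j)" by (simp add: exp_of_nat_mult mult.commute)
  also have "\<dots> \<le> exp (ln (1 + 2 * \<epsilon> * real n))" using j by (simp only: exp_le_cancel_iff q1)
  also have "\<dots> = 1 + 2 * \<epsilon> * real n" using \<epsilon> by (subst exp_ln) (auto intro: add_pos_nonneg)
  finally have "(q ^ j - 1) / (q - 1) \<le> 2 * \<epsilon> * real n / (q - 1)"
    using q by (intro divide_right_mono) auto
  also have "\<dots> = (1 - \<epsilon>) * real n" using \<epsilon> by (simp add: q1 field_simps)
  also have "\<dots> \<le> real n" using \<epsilon> by (simp add: algebra_simps)
  finally show ?thesis using gap_rank_upper[OF q, of j] by (simp flip: q_def)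
qed

lemma real_le_twice_max_floor: "t \<le> 2 * real (max 1 (nat \<lfloor>t\<rfloor>))"
  by (cases "t < 1") linarith+

text \<open>Every \<open>m\<close> up to \<open>D\<close> is offered because a small universe may
  force \<open>m\<close> below \<open>D\<close>. The bound by \<open>1 / \<epsilon>\<close> is kept
  separately since \<open>ln (\<epsilon> * n)\<close> may vanish.\<close>

lemma separated_ranks_exist:
  fixes \<epsilon> \<epsilon>\<^sub>0 :: real
  assumes \<epsilon>: "0 < \<epsilon>" "\<epsilon> \<le> \<epsilon>\<^sub>0" "\<epsilon>\<^sub>0 < 1" and n: "1 \<le> \<epsilon> * real n"
  obtains D where "1 \<le> D" "(1 - \<epsilon>\<^sub>0) / 4 * (1 / \<epsilon>) \<le> real D"
    "(1 - \<epsilon>\<^sub>0) / 4 * (ln (\<epsilon> * real n) / \<epsilon>) \<le> real D"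
    "\<And>m. 1 \<le> m \<Longrightarrow> m \<le> D \<Longrightarrow> \<exists>R. R 0 = 0 \<and> R m = n \<and>
       (\<forall>j<m. (1 + \<epsilon>) * real (R j) < (1 - \<epsilon>) * real (R (Suc j)))"
proof -
  define l where "l = ln (1 + 2 * \<epsilon> * real n)"
  \<comment> \<open>Solves the condition of \<open>gap_rank_le_exp\<close> for \<open>j\<close>,
    with \<open>1 - \<epsilon>\<close> replaced by its least value
    \<open>1 - \<epsilon>\<^sub>0\<close>. The maximum with 1 in \<open>D\<close> limits the loss
    from rounding down to a factor 2.\<close>
  define t where "t = (1 - \<epsilon>\<^sub>0) / (2 * \<epsilon>) * l"
  define D where "D = max 1 (nat \<lfloor>t\<rfloor>)"
  define q where "q = (1 + \<epsilon>) / (1 - \<epsilon>)"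
  have n0: "0 < n" using n by (cases n) auto
  have "exp 1 \<le> (3::real)" by (rule exp_le)
  also have "3 \<le> 1 + 2 * \<epsilon> * real n" using n by simp
  finally have l1: "1 \<le> l" unfolding l_def using n by (subst ln_ge_iff) auto
  have l2: "ln (\<epsilon> * real n) \<le> l" unfolding l_def using n by (subst ln_le_cancel_iff) auto
  have tD: "t \<le> 2 * real D" unfolding D_def by (rule real_le_twice_max_floor)
  have "(1 - \<epsilon>\<^sub>0) / 4 * (v / \<epsilon>) \<le> real D" if "v \<le> l" for v
  proof -
    have "(1 - \<epsilon>\<^sub>0) / 4 * (v / \<epsilon>) \<le> (1 - \<epsilon>\<^sub>0) / 4 * (l / \<epsilon>)"
      using that \<epsilon> by (intro mult_left_mono divide_right_mono) auto
    also have "\<dots> = t / 2" using \<epsilon> by (simp add: t_def field_simps)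
    finally show ?thesis using tD by linarith
  qed
  note large = this[OF l1] this[OF l2]
  have t0: "0 \<le> t" unfolding t_def using \<epsilon> l1 by auto
  have grD: "gap_rank q j \<le> n" if "j \<le> D" for j
  proof (cases "real j \<le> t")
    case True
    have "2 * \<epsilon> / (1 - \<epsilon>) * real j \<le> 2 * \<epsilon> / (1 - \<epsilon>\<^sub>0) * real j"
      using \<epsilon> by (intro mult_right_mono divide_left_mono) auto
    also have "\<dots> \<le> 2 * \<epsilon> / (1 - \<epsilon>\<^sub>0) * t" using \<epsilon> True by (intro mult_left_mono) auto
    also have "\<dots> = l" using \<epsilon> by (simp add: t_def)
    finally show ?thesis unfolding q_def l_def using \<epsilon> by (intro gap_rank_le_exp) auto
  next
    case False
    \<comment> \<open>Exceeding \<open>t\<close> is possible only where the maximum with 1 took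
      effect, and \<open>gap_rank q 1 = 1\<close> still fits below \<open>n\<close>.\<close>
    then have "j \<le> 1" using that t0 unfolding D_def by linarith
    then have "j = 0 \<or> j = 1" by auto
    then show ?thesis using n0 by auto
  qed
  have "\<exists>R. R 0 = 0 \<and> R m = n \<and> (\<forall>j<m. (1 + \<epsilon>) * real (R j) < (1 - \<epsilon>) * real (R (Suc j)))"
    if m: "1 \<le> m" "m \<le> D" for m
  proof (intro exI conjI allI impI)
    \<comment> \<open>Only the last rank is raised to \<open>n\<close>, which can only widen the
      last gap.\<close>
    let ?R = "\<lambda>j. if j < m then gap_rank q j else n"
    show "?R 0 = 0" "?R m = n" using m by auto
    fix j assume j: "j < m"
    have "gap_rank q (Suc j) \<le> ?R (Suc j)" using grD[of "Suc j"] j m by auto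
    then have "q * real (gap_rank q j) < real (?R (Suc j))"
      using gap_rank_greater[of q j] by linarith
    then show "(1 + \<epsilon>) * real (?R j) < (1 - \<epsilon>) * real (?R (Suc j))"
      using j \<epsilon> by (simp add: q_def field_simps)
  qed
  moreover have "1 \<le> D" by (simp add: D_def)
  ultimately show ?thesis using that large by blast
qed

section \<open>The bounds on the size\<close>

text \<open>The tangent bound for \<open>ln\<close> is applied at \<open>t / 2\<close>; this gains
  the factor 1/2, which lies below \<open>ln 2\<close>.\<close>

lemma log2_le_self:
  fixes t :: real
  assumes "0 < t"
  shows "log 2 t \<le> t"
proof -
  have "ln (t / 2) \<le> t / 2 - 1" using assms by (intro ln_le_minus_one) auto
  then have "ln t \<le> t / 2" using assms ln_2_less_1 by (simp add: ln_div)
  also have "\<dots> \<le> t * ln 2" using assms ln2_ge_two_thirds by simp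
  finally show ?thesis by (simp add: log_def pos_divide_le_eq)
qed

text \<open>Take logarithms in \<open>(k / m) ^ m \<le> (k choose m)\<close>. Since the binomial is
  at least 2, \<open>s = 0\<close> is impossible, and this absorbs the additive 2 into
  \<open>3 * s\<close>.\<close>

lemma size_ge_of_choose_le:
  assumes m: "1 \<le> m" "2 * m \<le> k"
    and le: "2 / 3 * real (k choose m) \<le> 2 ^ Suc s - 1"
  shows "real m * log 2 (real k / real m) \<le> 3 * real s"
proof -
  let ?N = "real (k choose m)"
  have km: "2 \<le> real k / real m" using m by (simp add: field_simps flip: of_nat_mult)
  have pow: "(real k / real m) ^ m \<le> ?N"
    using binomial_ge_n_over_k_pow_k[of m k, where 'a = real] m by simp
  have "(2::real) = 2 ^ 1" by simp
  also have "\<dots> \<le> 2 ^ m" using m by (intro power_increasing) auto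
  also have "\<dots> \<le> (real k / real m) ^ m" using km by (intro power_mono) auto
  finally have N: "2 \<le> ?N" using pow by simp
  have s: "1 \<le> s" using N le by (cases s) auto
  have "?N \<le> 2 ^ (s + 2)" using le N by simp
  also have "\<dots> = 2 powr (real s + 2)" by (simp add: powr_add powr_realpow)
  finally have "log 2 ?N \<le> real s + 2" using N m by (subst log_le_iff) auto
  moreover have "log 2 ((real k / real m) ^ m) \<le> log 2 ?N" using pow km m N by simp
  moreover have "log 2 ((real k / real m) ^ m) = real m * log 2 (real k / real m)"
    using km by (simp add: log_nat_power)
  ultimately show ?thesis using s by linarith
qed

text \<open>\<open>x * log 2 (k / x)\<close> is not monotone in \<open>x\<close>, hence the case distinctions.\<close>
lemma entropy_term_le:
  fixes \<kappa> x :: real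
  assumes x: "0 < x" and \<kappa>: "0 < \<kappa>" "\<kappa> \<le> 1" and D: "1 \<le> D" "\<kappa> * x \<le> real D" and k: "2 \<le> k"
    and m: "m = min D (k div 2)"
  shows "\<kappa> * (x * log 2 (real k / x)) \<le> 3 * (real m * log 2 (real k / real m))"
proof (cases "1 < real k / x")
  case False
  then have "log 2 (real k / x) \<le> 0" using x k by simp
  then have "\<kappa> * (x * log 2 (real k / x)) \<le> 0"
    using x \<kappa> by (simp add: mult_nonneg_nonpos)
  moreover have "0 \<le> real m * log 2 (real k / real m)"
  proof -
    have "1 \<le> m" "m \<le> k" using m D k by auto
    then show ?thesis by simp
  qed
  ultimately show ?thesis by linarith
next
  case True
  let ?g = "real m * log 2 (real k / real m)"
  have m1: "1 \<le> m" "2 * m \<le> k" using m D k by auto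
  then have "2 \<le> real k / real m" by (simp add: field_simps flip: of_nat_mult)
  then have "1 \<le> log 2 (real k / real m)" by simp
  then have g: "real m \<le> ?g" using m1 by simp
  have f0: "0 \<le> x * log 2 (real k / x)" using True x by auto
  then have f: "\<kappa> * (x * log 2 (real k / x)) \<le> x * log 2 (real k / x)"
    using \<kappa> by (simp add: mult_left_le_one_le)
  \<comment> \<open>First case: the universe limits \<open>m\<close>, and the left side is at most
    \<open>k \<le> 3 * m\<close>. Second: \<open>\<kappa> * x \<le> m\<close> and
    \<open>k / x \<le> k / m\<close>. Third: splitting off \<open>log 2 (m / x)\<close> costs at
    most \<open>m\<close>. Each time \<open>m \<le> ?g\<close> finishes.\<close>
  consider "k div 2 < D" | "m = D" "real m \<le> x" | "x \<le> real m" using m by linarith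
  then show ?thesis
  proof cases
    case 1
    have "x * log 2 (real k / x) \<le> x * (real k / x)"
      using x k by (intro mult_left_mono log2_le_self) auto
    also have "\<dots> = real k" using x by simp
    also have "\<dots> \<le> 3 * real m"
    proof -
      have "k \<le> 3 * (k div 2)" using k by presburger
      then show ?thesis using 1 m by simp
    qed
    finally show ?thesis using f g by linarith
  next
    case 2
    have "\<kappa> * x * log 2 (real k / x) \<le> real m * log 2 (real k / x)"
      using 2 D True by (intro mult_right_mono) auto
    also have "\<dots> \<le> ?g"
      using 2 m1 x k by (intro mult_left_mono) (auto intro!: divide_left_mono)
    finally show ?thesis using g by (simp add: mult.assoc)
  next
    case 3
    have "log 2 (real k / x) = log 2 (real k / real m) + log 2 (real m / x)"
      using m1 x k by (simp add: log_divide_pos)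
    then have "x * log 2 (real k / x) = x * log 2 (real k / real m) + x * log 2 (real m / x)"
      by (simp only: distrib_left)
    also have "\<dots> \<le> ?g + x * (real m / x)"
      using 3 m1 x \<open>1 \<le> log 2 (real k / real m)\<close>
      by (intro add_mono mult_right_mono mult_left_mono log2_le_self) auto
    also have "\<dots> = ?g + real m" using x by simp
    finally show ?thesis using f g by linarith
  qed
qed

text \<open>The first bound is \<open>entropy_term_le\<close> at \<open>x = L / \<epsilon>\<close>;
  the second covers bounded \<open>L * log 2 (\<epsilon> * card U)\<close>. The 9 is a product of
  two factors 3: one from bounding the size by \<open>m * log 2 (k / m)\<close>, one from comparing
  that term with the target.\<close>

lemma sketch_size_lower_bounds:
  fixes \<epsilon> \<epsilon>\<^sub>0 :: real and U :: "'a::linorder set"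
  assumes solves: "solves_all_quantiles M sketch query U n \<epsilon> (2/3)"
    and size: "sketch_size_le M sketch U n s"
    and \<epsilon>: "0 < \<epsilon>" "\<epsilon> \<le> \<epsilon>\<^sub>0" "\<epsilon>\<^sub>0 < 1" and n: "1 \<le> \<epsilon> * real n"
    and U: "finite U" "2 \<le> card U"
  defines "\<kappa> \<equiv> (1 - \<epsilon>\<^sub>0) / 4 * ln 2" and "L \<equiv> log 2 (\<epsilon> * real n)"
  shows "\<kappa> / 9 * ((1 / \<epsilon>) * L * log 2 (\<epsilon> * real (card U) / L)) \<le> real s"
    and "1 < \<epsilon> * real (card U) \<Longrightarrow> \<kappa> / 9 * (1 / \<epsilon>) \<le> real s"
proof -
  obtain D where D: "1 \<le> D" "(1 - \<epsilon>\<^sub>0) / 4 * (1 / \<epsilon>) \<le> real D"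
    "(1 - \<epsilon>\<^sub>0) / 4 * (ln (\<epsilon> * real n) / \<epsilon>) \<le> real D"
    and ex: "\<And>m. 1 \<le> m \<Longrightarrow> m \<le> D \<Longrightarrow> \<exists>R. R 0 = 0 \<and> R m = n \<and>
       (\<forall>j<m. (1 + \<epsilon>) * real (R j) < (1 - \<epsilon>) * real (R (Suc j)))"
    using separated_ranks_exist[OF \<epsilon> n] by metis
  define k where "k = card U"
  \<comment> \<open>The cap \<open>k div 2\<close> keeps \<open>k / m\<close> at least 2, so that
    the logarithm is at least 1.\<close>
  define m where "m = min D (k div 2)"
  have m: "1 \<le> m" "m \<le> D" "2 * m \<le> k" using D U by (auto simp: m_def k_def)
  obtain R where R: "R 0 = 0" "R m = n"
    "\<And>j. j < m \<Longrightarrow> (1 + \<epsilon>) * real (R j) < (1 - \<epsilon>) * real (R (Suc j))"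
    using ex[OF m(1,2)] by blast
  have "2 / 3 * real (k choose m) \<le> 2 ^ Suc s - 1"
    unfolding k_def using \<epsilon>
    by (intro choose_subsets_le_of_separated_ranks[OF solves size _ U(1) _ _ R]) auto
  then have bound: "real m * log 2 (real k / real m) \<le> 3 * real s"
    using m by (intro size_ge_of_choose_le) auto
  have ninth: "\<kappa> / 9 * y \<le> real s" if "\<kappa> * y \<le> 9 * real s" for y
    using that by simp
  have "\<kappa> \<le> (1 - \<epsilon>\<^sub>0) / 4 * 1"
    unfolding \<kappa>_def using \<epsilon> ln_2_less_1 by (intro mult_left_mono) auto
  then have \<kappa>: "\<kappa> \<le> (1 - \<epsilon>\<^sub>0) / 4" "\<kappa> \<le> 1" using \<epsilon> by simp_all
  have \<kappa>_pos: "0 < \<kappa>" using \<epsilon> by (simp add: \<kappa>_def)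
  have L0: "0 \<le> L" using n by (simp add: L_def)
  show "\<kappa> / 9 * ((1 / \<epsilon>) * L * log 2 (\<epsilon> * real (card U) / L)) \<le> real s"
  proof (cases "L = 0")
    case False
    \<comment> \<open>The factor \<open>ln 2\<close> in \<open>\<kappa>\<close> converts the natural
      logarithm in the bound on \<open>D\<close> to base 2.\<close>
    have "\<kappa> * (L / \<epsilon>) = (1 - \<epsilon>\<^sub>0) / 4 * (ln (\<epsilon> * real n) / \<epsilon>)"
      by (simp add: \<kappa>_def L_def log_def)
    then have "\<kappa> * (L / \<epsilon> * log 2 (real k / (L / \<epsilon>))) \<le> 3 * (real m * log 2 (real k / real m))"
      using False L0 \<epsilon> \<kappa> \<kappa>_pos D U by (intro entropy_term_le[of _ _ D]) (auto simp: m_def k_def)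
    also have "\<dots> \<le> 9 * real s" using bound by simp
    finally have "\<kappa> / 9 * (L / \<epsilon> * log 2 (real k / (L / \<epsilon>))) \<le> real s" by (rule ninth)
    moreover have "real k / (L / \<epsilon>) = \<epsilon> * real (card U) / L" by (simp add: k_def)
    moreover have "L / \<epsilon> = (1 / \<epsilon>) * L" by simp
    ultimately show ?thesis by metis
  qed simp
  show "\<kappa> / 9 * (1 / \<epsilon>) \<le> real s" if u: "1 < \<epsilon> * real (card U)"
  proof -
    have "\<kappa> * (1 / \<epsilon>) \<le> (1 - \<epsilon>\<^sub>0) / 4 * (1 / \<epsilon>)" using \<kappa> \<epsilon> by (intro mult_right_mono) auto
    then have a: "\<kappa> * (1 / \<epsilon>) \<le> real D" using D by linarith
    have "\<kappa> * (1 / \<epsilon>) \<le> 1 * (1 / \<epsilon>)" using \<kappa> \<epsilon> by (intro mult_right_mono) auto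
    also have "\<dots> \<le> real k" using u \<epsilon> by (simp add: k_def field_simps)
    also have "\<dots> \<le> 3 * real (k div 2)"
    proof -
      have "k \<le> 3 * (k div 2)" using U(2) unfolding k_def by presburger
      then show ?thesis by simp
    qed
    finally have "\<kappa> * (1 / \<epsilon>) \<le> 3 * real m" using a by (auto simp: m_def min_def)
    moreover have "real m * 1 \<le> real m * log 2 (real k / real m)"
    proof (rule mult_left_mono)
      have "2 \<le> real k / real m" using m by (simp add: field_simps flip: of_nat_mult)
      then show "1 \<le> log 2 (real k / real m)" by simp
    qed simp
    ultimately show ?thesis using bound by linarith
  qed
qed

text \<open>
  \<open>C * L powr (1 + \<delta>) \<le> u\<close> makes \<open>log (u / L)\<close> comparable to \<open>log u\<close> unless \<open>u\<close> is bounded in terms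
  of \<open>C\<close> and \<open>\<delta>\<close>; in that case \<open>L * log u\<close> is bounded as well.
\<close>
lemma log_le_log_quotient_or_bounded:
  fixes C \<delta> L u :: real
  assumes C: "0 < C" "0 < \<delta>" and L: "0 < L" and u: "1 < u" and le: "C * L powr (1 + \<delta>) \<le> u"
  defines "B \<equiv> \<bar>log 2 C\<bar>"
  defines "A \<equiv> 2 * B / \<delta>"
  shows "\<delta> / (2 * (1 + \<delta>)) * log 2 u \<le> log 2 (u / L) \<or> L * log 2 u \<le> 2 powr (A + B) * (A + 1)"
proof -
  define a where "a = log 2 u"
  define l where "l = log 2 L"
  have a: "0 < a" using u by (simp add: a_def)
  have B: "0 \<le> B" "- B \<le> log 2 C" by (auto simp: B_def)
  have A: "0 \<le> A" using B C by (simp add: A_def)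
  have "log 2 (C * L powr (1 + \<delta>)) \<le> a" unfolding a_def using C L u le by simp
  then have "log 2 C + (1 + \<delta>) * l \<le> a" using C L by (simp add: log_mult_pos log_powr l_def)
  then have l: "(1 + \<delta>) * l \<le> a + B" using B by linarith
  have q: "log 2 (u / L) = a - l" using u L by (simp add: log_divide_pos a_def l_def)
  show ?thesis
  \<comment> \<open>If \<open>B \<le> \<delta> * a / 2\<close>, then \<open>l\<close> gives
    \<open>(1 + \<delta>) * (a - l) \<ge> \<delta> * a - B \<ge> \<delta> * a / 2\<close>. Otherwise
    \<open>a\<close> is below \<open>A\<close>, and so \<open>l\<close> is bounded too.\<close>
  proof (cases "2 * B \<le> \<delta> * a")
    case True
    have "\<delta> * a \<le> 2 * (1 + \<delta>) * (a - l)" using True l by (simp add: algebra_simps)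
    then have "\<delta> / (2 * (1 + \<delta>)) * a \<le> a - l" using C by (simp add: field_simps)
    then show ?thesis using q by (simp add: a_def)
  next
    case False
    then have aA: "a \<le> A" using C by (simp add: A_def field_simps)
    have "l \<le> A + B"
    proof (cases "0 \<le> l")
      case True
      then have "l \<le> (1 + \<delta>) * l" using C by (simp add: algebra_simps)
      then show ?thesis using l aA by linarith
    qed (use A B in linarith)
    then have "L \<le> 2 powr (A + B)" using L by (simp add: l_def log_le_iff)
    then have "L * a \<le> 2 powr (A + B) * (A + 1)" using L a aA by (intro mult_mono) auto
    then show ?thesis by (simp add: a_def)
  qed
qed

text \<open>The constant \<open>c\<close> depends only on \<open>\<epsilon>\<^sub>0\<close>,
  \<open>C\<close> and \<open>\<delta>\<close>. Counting subsets yields \<open>log (u / L)\<close>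
  with \<open>u = \<epsilon> * card U\<close> and \<open>L = log 2 (\<epsilon> * n)\<close>. At
  \<open>u = C * L\<close> this is constant while \<open>log u\<close> grows with \<open>L\<close>;
  the exponent \<open>1 + \<delta>\<close> makes the two comparable. In the second bound
  \<open>2 \<le> card U\<close> excludes singletons: they need no bits, yet the left side is
  positive for \<open>0 < L < \<epsilon>\<close>.\<close>

theorem theorem4:
  fixes \<epsilon>\<^sub>0 C \<delta> :: real
  assumes "0 < \<epsilon>\<^sub>0" "\<epsilon>\<^sub>0 < 1" "0 < C" "0 < \<delta>"
  shows "\<exists>c>0. \<forall>(\<epsilon>::real) (n::nat) (U::'a::linorder set) (M::'w measure) sketch query (s::nat).
           0 < \<epsilon> \<longrightarrow> \<epsilon> \<le> \<epsilon>\<^sub>0 \<longrightarrow> 1 \<le> \<epsilon> * real n \<longrightarrow> finite U \<longrightarrow>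
           solves_all_quantiles M sketch query U n \<epsilon> (2/3) \<longrightarrow>
           sketch_size_le M sketch U n s \<longrightarrow>
             (C * (1 / \<epsilon>) * log 2 (\<epsilon> * real n) powr (1 + \<delta>) \<le> real (card U) \<longrightarrow>
                c * ((1 / \<epsilon>) * log 2 (\<epsilon> * real n) * log 2 (\<epsilon> * real (card U))) \<le> real s) \<and>
             (C * (1 / \<epsilon>) * log 2 (\<epsilon> * real n) \<le> real (card U) \<longrightarrow> 2 \<le> card U \<longrightarrow>
                c * ((1 / \<epsilon>) * log 2 (\<epsilon> * real n) *
                     log 2 (\<epsilon> * real (card U) / log 2 (\<epsilon> * real n))) \<le> real s)"
proof -
  define \<kappa> where "\<kappa> = (1 - \<epsilon>\<^sub>0) / 4 * ln 2"
  define B where "B = \<bar>log 2 C\<bar>"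
  define A where "A = 2 * B / \<delta>"
  \<comment> \<open>The summand 1 keeps \<open>K\<close> positive when \<open>C = 1\<close>, where
    \<open>A = 0\<close>. In \<open>c\<close>, \<open>\<theta>\<close> serves the case of comparable
    logarithms and \<open>1 / K\<close> the bounded case.\<close>
  define K where "K = 2 powr (A + B) * (A + 1)"
  define \<theta> where "\<theta> = \<delta> / (2 * (1 + \<delta>))"
  define c where "c = \<kappa> / 9 * min \<theta> (1 / K)"
  have \<kappa>: "0 < \<kappa>" using assms by (simp add: \<kappa>_def)
  have "0 \<le> A" using assms by (simp add: A_def B_def)
  then have K: "0 < K" by (simp add: K_def)
  have \<theta>: "0 < \<theta>" "\<theta> \<le> 1" using assms by (auto simp: \<theta>_def field_simps)
  have c0: "0 < c" using \<kappa> K \<theta> by (simp add: c_def)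
  have c: "c \<le> \<kappa> / 9 * \<theta>" "c \<le> \<kappa> / 9 * (1 / K)"
    unfolding c_def using \<kappa> by (intro mult_left_mono; simp)+
  have "\<kappa> / 9 * \<theta> \<le> \<kappa> / 9 * 1" using \<kappa> \<theta> by (intro mult_left_mono) auto
  then have c\<kappa>: "c \<le> \<kappa> / 9" using c by linarith
  show ?thesis
  proof (intro exI[of _ c] conjI allI impI)
    show "0 < c" by (rule c0)
  next
    fix \<epsilon> :: real and n :: nat and U :: "'a set" and M :: "'w measure" and sketch query and s :: nat
    assume \<epsilon>: "0 < \<epsilon>" "\<epsilon> \<le> \<epsilon>\<^sub>0" and n: "1 \<le> \<epsilon> * real n" and U: "finite U"
      and solves: "solves_all_quantiles M sketch query U n \<epsilon> (2/3)"
      and size: "sketch_size_le M sketch U n s"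
    define L where "L = log 2 (\<epsilon> * real n)"
    have L0: "0 \<le> L" using n by (simp add: L_def)
    note bounds = sketch_size_lower_bounds[OF solves size \<epsilon> assms(2) n U, folded \<kappa>_def L_def]
    have quot: "c' * ((1 / \<epsilon>) * L * log 2 (\<epsilon> * real (card U) / L)) \<le> real s"
      if "2 \<le> card U" "0 \<le> c'" "c' \<le> \<kappa> / 9" for c'
    \<comment> \<open>When \<open>L\<close> exceeds \<open>\<epsilon> * card U\<close> the product
      may be negative; lowering the constant then raises the left side, but it stays
      nonpositive.\<close>
    proof (cases "0 \<le> (1 / \<epsilon>) * L * log 2 (\<epsilon> * real (card U) / L)")
      case True
      then have "c' * ((1 / \<epsilon>) * L * log 2 (\<epsilon> * real (card U) / L)) \<le>
          \<kappa> / 9 * ((1 / \<epsilon>) * L * log 2 (\<epsilon> * real (card U) / L))"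
        using that by (intro mult_right_mono) auto
      then show ?thesis using bounds(1) that by linarith
    next
      case False
      then have "c' * ((1 / \<epsilon>) * L * log 2 (\<epsilon> * real (card U) / L)) \<le> 0"
        by (intro mult_nonneg_nonpos[OF that(2)]) (use False in linarith)
      then show ?thesis by (rule order_trans) simp
    qed
    show "c * ((1 / \<epsilon>) * log 2 (\<epsilon> * real n) *
            log 2 (\<epsilon> * real (card U) / log 2 (\<epsilon> * real n))) \<le> real s" if "2 \<le> card U"
      using quot[OF that _ c\<kappa>] c0 by (simp add: L_def)
    show "c * ((1 / \<epsilon>) * log 2 (\<epsilon> * real n) * log 2 (\<epsilon> * real (card U))) \<le> real s"
      if large: "C * (1 / \<epsilon>) * log 2 (\<epsilon> * real n) powr (1 + \<delta>) \<le> real (card U)"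
    proof -
      define u where "u = \<epsilon> * real (card U)"
      have "c * ((1 / \<epsilon>) * L * log 2 u) \<le> real s"
      proof (cases "0 < L \<and> 1 < u")
        case False
        have "(1 / \<epsilon>) * L * log 2 u \<le> 0"
        proof (cases "L = 0")
          case nz: False
          then have "u \<le> 1" using False L0 by auto
          moreover have "u \<noteq> 0 \<Longrightarrow> 0 < u" using \<epsilon> by (simp add: u_def zero_less_mult_iff)
          \<comment> \<open>An empty universe gives \<open>u = 0\<close>, where
            \<open>log 2 0 = 0\<close> by convention.\<close>
          ultimately have "log 2 u \<le> 0" by (cases "u = 0") (simp add: log_def, simp)
          then show ?thesis using \<epsilon> L0 by (intro mult_nonneg_nonpos) auto
        qed simp
        then have "c * ((1 / \<epsilon>) * L * log 2 u) \<le> 0" by (rule mult_nonneg_nonpos[OF less_imp_le[OF c0]])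
        then show ?thesis by (rule order_trans) simp
      next
        case True
        have "real (card U) > 1"
        proof -
          have "u \<le> 1 * real (card U)"
            unfolding u_def using \<epsilon> assms by (intro mult_right_mono) auto
          then show ?thesis using True by linarith
        qed
        then have U2: "2 \<le> card U" by simp
        have le: "C * L powr (1 + \<delta>) \<le> u" using large \<epsilon> by (simp add: u_def L_def field_simps)
        from log_le_log_quotient_or_bounded[OF assms(3,4) _ _ le, folded B_def, folded A_def,
            folded K_def \<theta>_def] True
        consider "\<theta> * log 2 u \<le> log 2 (u / L)" | "L * log 2 u \<le> K" by blast
        then show ?thesis
        proof cases
          case 1
          have pos: "0 \<le> (1 / \<epsilon>) * L * log 2 u" using True \<epsilon> by auto
          have "c * ((1 / \<epsilon>) * L * log 2 u) \<le> \<kappa> / 9 * \<theta> * ((1 / \<epsilon>) * L * log 2 u)"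
            using c pos by (intro mult_right_mono)
          also have "\<dots> = \<kappa> / 9 * ((1 / \<epsilon>) * L * (\<theta> * log 2 u))" by simp
          also have "\<dots> \<le> \<kappa> / 9 * ((1 / \<epsilon>) * L * log 2 (u / L))"
            using 1 \<kappa> \<epsilon> L0 by (intro mult_left_mono) auto
          also have "\<dots> \<le> real s" using bounds(1)[OF U2] by (simp add: u_def)
          finally show ?thesis .
        next
          case 2
          \<comment> \<open>As \<open>L * log 2 u\<close> is at most \<open>K\<close>, the target is
            of order \<open>1 / \<epsilon>\<close>, which the second size bound supplies.\<close>
          have "c * ((1 / \<epsilon>) * L * log 2 u) = c * (1 / \<epsilon>) * (L * log 2 u)" by simp
          also have "\<dots> \<le> c * (1 / \<epsilon>) * K" using 2 c0 \<epsilon> by (intro mult_left_mono) auto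
          also have "\<dots> \<le> \<kappa> / 9 * (1 / K) * (1 / \<epsilon>) * K"
            using c K \<epsilon> by (intro mult_right_mono) auto
          also have "\<dots> = \<kappa> / 9 * (1 / \<epsilon>)" using K by simp
          also have "\<dots> \<le> real s" using bounds(2)[OF U2] True by (simp add: u_def)
          finally show ?thesis .
        qed
      qed
      then show ?thesis by (simp add: L_def u_def)
    qed
  qed
qed

end
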